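(* Let $(P,A,\lambda)$ be a marked poset and let $(U_1,U_2)$ and $(V_1,V_2)$ be two different admissible decompositions of it. If $U_1\cap\operatorname{St}(P)=V_1\cap\operatorname{St}(P)$, then the marked chain-order polytopes $\mathcal{CO}_{U_1,U_2}(\lambda)$ and $\mathcal{CO}_{V_1,V_2}(\lambda)$ are unimodular equivalent.
   Context: A marked poset is a triple $(P,A,\lambda)$ where $(P,\prec)$ is a finite poset, $A\subseteq P$ contains all minimal and all maximal elements of $P$, and $\lambda:A\to\mathbb{Z}_{\ge 0}$, $a\mapsto\lambda_a$. For $p,q\in P$ write $q\to p$ ("$p$ covers $q$") if $q\prec p$ and there is no $r$ with $q\prec r\prec p$. Let $p\to$ denote the set of elements covering $p$, and $\rightsquigarrow p$ the set of maximal chains ending in $p$, i.e. chains $r_0\to r_1\to\cdots\to r_k=p$ with $r_0$ minimal in $P$. An element $p\in P$ is a star element if $|p\to|\ge 2$ and $|\rightsquigarrow p|\ge 2$; $\operatorname{St}(P)$ is the set of star elements. A decomposition of $(P,A,\lambda)$ is a pair $(U_1,U_2)$ of disjoint sets with $U_1\cup U_2=P\setminus A$; it is admissible if there are no $u_1\in U_1$, $u_2\in U_2$ with $u_1\prec u_2$. Put $A_1=A\cup U_1$. The marked chain-order polytope $\mathcal{CO}_{U_1,U_2}(\lambda)\subset\mathbb{R}^{P\setminus A}$ is the set of $(x_p)_{p\in P\setminus A}$ such that: (i) $x_p\le\lambda_a$ whenever $p\in U_1$, $a\in A$, $p\prec a$; (ii) $\lambda_b\le x_q$ whenever $q\in U_1$,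 $b\in A$, $b\prec q$; (iii) $x_p\le x_q$ whenever $p,q\in U_1$, $p\prec q$; (iv) $x_p\ge0$ for $p\in U_2$; (v) for every chain $b\prec p_n\prec\cdots\prec p_1\prec a$ with $n\ge1$, $a,b\in A_1$, $p_i\in U_2$: $x_{p_1}+\cdots+x_{p_n}\le\lambda_a-\lambda_b$, where $\lambda_q$ means $x_q$ for $q\in U_1$; (vi) for every chain $p_1\prec\cdots\prec p_s\prec q$ with $q\in U_1$, $p_i\in U_2$: $x_{p_1}+\cdots+x_{p_s}\le x_q$. *)

theory Defs
  imports Complex_Main
begin

definition strict_poset :: "'a set \<Rightarrow> ('a \<Rightarrow> 'a \<Rightarrow> bool) \<Rightarrow> bool" where
  "strict_poset P lt \<longleftrightarrow> finite P \<and> (\<forall>x y. lt x y \<longrightarrow> x \<in> P \<and> y \<in> P)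
     \<and> (\<forall>x\<in>P. \<not> lt x x) \<and> (\<forall>x y z. lt x y \<longrightarrow> lt y z \<longrightarrow> lt x z)"

definition minimal_el :: "'a set \<Rightarrow> ('a \<Rightarrow> 'a \<Rightarrow> bool) \<Rightarrow> 'a \<Rightarrow> bool" where
  "minimal_el P lt p \<longleftrightarrow> p \<in> P \<and> \<not> (\<exists>q\<in>P. lt q p)"

definition maximal_el :: "'a set \<Rightarrow> ('a \<Rightarrow> 'a \<Rightarrow> bool) \<Rightarrow> 'a \<Rightarrow> bool" where
  "maximal_el P lt p \<longleftrightarrow> p \<in> P \<and> \<not> (\<exists>q\<in>P. lt p q)"

text \<open>Marked poset (P, A, lambda); the marking lam is given on all of 'a but only used on A.\<close>
definition marked_poset :: "'a set \<Rightarrow> ('a \<Rightarrow> 'a \<Rightarrow> bool) \<Rightarrow> 'a set \<Rightarrow> ('a \<Rightarrow> nat) \<Rightarrow> bool" where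
  "marked_poset P lt A lam \<longleftrightarrow> strict_poset P lt \<and> A \<subseteq> P
     \<and> (\<forall>p. minimal_el P lt p \<longrightarrow> p \<in> A) \<and> (\<forall>p. maximal_el P lt p \<longrightarrow> p \<in> A)"

definition covers :: "'a set \<Rightarrow> ('a \<Rightarrow> 'a \<Rightarrow> bool) \<Rightarrow> 'a \<Rightarrow> 'a \<Rightarrow> bool" where
  "covers P lt q p \<longleftrightarrow> lt q p \<and> \<not> (\<exists>r\<in>P. lt q r \<and> lt r p)"

definition covering_set :: "'a set \<Rightarrow> ('a \<Rightarrow> 'a \<Rightarrow> bool) \<Rightarrow> 'a \<Rightarrow> 'a set" where
  "covering_set P lt p = {q \<in> P. covers P lt p q}"

definition max_chains_to :: "'a set \<Rightarrow> ('a \<Rightarrow> 'a \<Rightarrow> bool) \<Rightarrow> 'a \<Rightarrow> 'a list set" where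
  "max_chains_to P lt p = {cs. cs \<noteq> [] \<and> minimal_el P lt (hd cs) \<and> last cs = p
       \<and> successively (covers P lt) cs}"

definition star_elements :: "'a set \<Rightarrow> ('a \<Rightarrow> 'a \<Rightarrow> bool) \<Rightarrow> 'a set" where
  "star_elements P lt = {p \<in> P. card (covering_set P lt p) \<ge> 2 \<and> card (max_chains_to P lt p) \<ge> 2}"

definition admissible_decomp :: "'a set \<Rightarrow> ('a \<Rightarrow> 'a \<Rightarrow> bool) \<Rightarrow> 'a set \<Rightarrow> 'a set \<Rightarrow> 'a set \<Rightarrow> bool" where
  "admissible_decomp P lt A U1 U2 \<longleftrightarrow> U1 \<inter> U2 = {} \<and> U1 \<union> U2 = P - A
     \<and> \<not> (\<exists>u1\<in>U1. \<exists>u2\<in>U2. lt u1 u2)"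

definition lamx :: "'a set \<Rightarrow> ('a \<Rightarrow> nat) \<Rightarrow> ('a \<Rightarrow> real) \<Rightarrow> 'a \<Rightarrow> real" where
  "lamx A lam x q = (if q \<in> A then real (lam q) else x q)"

text \<open>Marked chain-order polytope, as a subset of R^(P - A) realised as functions 'a \<Rightarrow> real
  vanishing outside P - A. Chains p_1 \<succ> p_2 \<succ> ... \<succ> p_n are lists [p_1,...,p_n].\<close>
definition chain_order_polytope ::
  "'a set \<Rightarrow> ('a \<Rightarrow> 'a \<Rightarrow> bool) \<Rightarrow> 'a set \<Rightarrow> ('a \<Rightarrow> nat) \<Rightarrow> 'a set \<Rightarrow> 'a set \<Rightarrow> ('a \<Rightarrow> real) set" where
  "chain_order_polytope P lt A lam U1 U2 = {x.
     (\<forall>p. p \<notin> P - A \<longrightarrow> x p = 0)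
   \<and> (\<forall>p\<in>U1. \<forall>a\<in>A. lt p a \<longrightarrow> x p \<le> real (lam a))
   \<and> (\<forall>q\<in>U1. \<forall>b\<in>A. lt b q \<longrightarrow> real (lam b) \<le> x q)
   \<and> (\<forall>p\<in>U1. \<forall>q\<in>U1. lt p q \<longrightarrow> x p \<le> x q)
   \<and> (\<forall>p\<in>U2. 0 \<le> x p)
   \<and> (\<forall>a\<in>A \<union> U1. \<forall>b\<in>A \<union> U1. \<forall>cs. cs \<noteq> [] \<and> set cs \<subseteq> U2
         \<and> sorted_wrt (\<lambda>u v. lt v u) cs \<and> lt b (last cs) \<and> lt (hd cs) a
         \<longrightarrow> sum_list (map x cs) \<le> lamx A lam x a - lamx A lam x b)
   \<and> (\<forall>q\<in>U1. \<forall>cs. cs \<noteq> [] \<and> set cs \<subseteq> U2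
         \<and> sorted_wrt lt cs \<and> lt (last cs) q
         \<longrightarrow> sum_list (map x cs) \<le> x q)}"

definition unimodular_equiv :: "'a set \<Rightarrow> ('a \<Rightarrow> real) set \<Rightarrow> ('a \<Rightarrow> real) set \<Rightarrow> bool" where
  "unimodular_equiv Q S T \<longleftrightarrow> (\<exists>(M::'a \<Rightarrow> 'a \<Rightarrow> int) (N::'a \<Rightarrow> 'a \<Rightarrow> int) (t::'a \<Rightarrow> int).
     (\<forall>p\<in>Q. \<forall>q\<in>Q. (\<Sum>r\<in>Q. M p r * N r q) = (if p = q then 1 else 0))
   \<and> (\<forall>p\<in>Q. \<forall>q\<in>Q. (\<Sum>r\<in>Q. N p r * M r q) = (if p = q then 1 else 0))
   \<and> T = (\<lambda>x. \<lambda>p. if p \<in> Q then (\<Sum>q\<in>Q. real_of_int (M p q) * x q) + real_of_int (t p) else 0) ` S)"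

end

theory Submission
  imports Defs
begin

text \<open>
  Passing through \<open>U1 \<inter> V1\<close> and removing minimal elements one at a time, it suffices to move a single
  non-star element \<open>p\<close> from the order part to the chain part. Separating the conditions that do not
  involve \<open>x p\<close>, the first polytope says \<open>l \<le> x p \<le> h\<close> for all lower expressions \<open>l\<close> (chain sums below
  \<open>p\<close> plus the mark at their bottom) and all upper expressions \<open>h\<close> (values at elements above \<open>p\<close>),
  while the second says \<open>0 \<le> x p\<close> and \<open>l + x p \<le> h\<close>. If \<open>p\<close> has a unique cover, the other conditions
  single out a smallest \<open>h\<close>, and \<open>x p \<mapsto> h - x p\<close> is the required map; if only one maximal chain ends
  in \<open>p\<close>, they single out a largest \<open>l\<close>, and \<open>x p \<mapsto> x p - l\<close> is.
\<close>

section \<open>Unimodular equivalence\<close>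

definition mat_prod :: "'a set \<Rightarrow> ('a \<Rightarrow> 'a \<Rightarrow> int) \<Rightarrow> ('a \<Rightarrow> 'a \<Rightarrow> int) \<Rightarrow> 'a \<Rightarrow> 'a \<Rightarrow> int" where
  "mat_prod Q M N p q = (\<Sum>r\<in>Q. M p r * N r q)"

text \<open>Matrices are total functions on the type; only entries with indices in \<open>Q\<close>
  carry meaning, so the identity is tested only there.\<close>

definition is_mat_id :: "'a set \<Rightarrow> ('a \<Rightarrow> 'a \<Rightarrow> int) \<Rightarrow> bool" where
  "is_mat_id Q M \<longleftrightarrow> (\<forall>p\<in>Q. \<forall>q\<in>Q. M p q = (if p = q then 1 else 0))"

definition affine_map ::
  "'a set \<Rightarrow> ('a \<Rightarrow> 'a \<Rightarrow> int) \<Rightarrow> ('a \<Rightarrow> int) \<Rightarrow> ('a \<Rightarrow> real) \<Rightarrow> 'a \<Rightarrow> real" where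
  "affine_map Q M t x =
     (\<lambda>p. if p \<in> Q then (\<Sum>q\<in>Q. real_of_int (M p q) * x q) + real_of_int (t p) else 0)"

lemma unimodular_equiv_iff:
  "unimodular_equiv Q S T \<longleftrightarrow> (\<exists>M N t. is_mat_id Q (mat_prod Q M N) \<and> is_mat_id Q (mat_prod Q N M)
     \<and> T = affine_map Q M t ` S)"
  by (simp add: unimodular_equiv_def is_mat_id_def mat_prod_def affine_map_def[abs_def])

section \<open>Products of integer matrices and composition of affine maps\<close>

lemma mat_prod_assoc:
  "mat_prod Q (mat_prod Q L M) N p q = mat_prod Q L (mat_prod Q M N) p q"
proof -
  have "mat_prod Q (mat_prod Q L M) N p q = (\<Sum>r\<in>Q. \<Sum>s\<in>Q. L p s * M s r * N r q)"
    by (simp add: mat_prod_def sum_distrib_right)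
  also have "\<dots> = (\<Sum>s\<in>Q. \<Sum>r\<in>Q. L p s * M s r * N r q)"
    by (rule sum.swap)
  also have "\<dots> = mat_prod Q L (mat_prod Q M N) p q"
    by (simp add: mat_prod_def sum_distrib_left mult.assoc)
  finally show ?thesis .
qed

lemma mat_prod_id_left:
  assumes "finite Q" "is_mat_id Q M" "p \<in> Q"
  shows "mat_prod Q M N p q = N p q"
proof -
  have "mat_prod Q M N p q = (\<Sum>r\<in>Q. if p = r then N r q else 0)"
    unfolding mat_prod_def using assms(2,3) by (intro sum.cong) (auto simp: is_mat_id_def)
  then show ?thesis using assms by simp
qed

text \<open>Associativity brings \<open>mat_prod Q M N\<close> into the middle, where it
  cancels.\<close>

lemma is_mat_id_prod:
  assumes "finite Q" "is_mat_id Q (mat_prod Q M N)" "is_mat_id Q (mat_prod Q M' N')"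
  shows "is_mat_id Q (mat_prod Q (mat_prod Q M' M) (mat_prod Q N N'))"
proof -
  have "mat_prod Q (mat_prod Q M' M) (mat_prod Q N N') p q = mat_prod Q M' N' p q" for p q
  proof -
    have "mat_prod Q (mat_prod Q M' M) (mat_prod Q N N') p q
        = mat_prod Q M' (mat_prod Q (mat_prod Q M N) N') p q"
      unfolding mat_prod_assoc by (simp add: mat_prod_def[of Q M'] mat_prod_assoc)
    also have "\<dots> = mat_prod Q M' N' p q"
      unfolding mat_prod_def[of Q M'] using assms
      by (intro sum.cong) (auto simp: mat_prod_id_left)
    finally show ?thesis .
  qed
  then show ?thesis using assms(3) by (simp add: is_mat_id_def)
qed

lemma affine_map_comp:
  "affine_map Q M t (affine_map Q N s x) =
   affine_map Q (mat_prod Q M N) (\<lambda>p. (\<Sum>q\<in>Q. M p q * s q) + t p) x"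
proof
  fix p
  have "(\<Sum>q\<in>Q. real_of_int (M p q) * ((\<Sum>r\<in>Q. real_of_int (N q r) * x r) + real_of_int (s q)))
     = (\<Sum>q\<in>Q. \<Sum>r\<in>Q. real_of_int (M p q) * real_of_int (N q r) * x r)
       + (\<Sum>q\<in>Q. real_of_int (M p q) * real_of_int (s q))"
    by (simp add: distrib_left sum.distrib sum_distrib_left mult.assoc)
  also have "(\<Sum>q\<in>Q. \<Sum>r\<in>Q. real_of_int (M p q) * real_of_int (N q r) * x r)
     = (\<Sum>r\<in>Q. real_of_int (mat_prod Q M N p r) * x r)"
    by (subst sum.swap) (simp add: mat_prod_def sum_distrib_right)
  finally show "affine_map Q M t (affine_map Q N s x) p =
     affine_map Q (mat_prod Q M N) (\<lambda>p. (\<Sum>q\<in>Q. M p q * s q) + t p) x p"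
    by (simp add: affine_map_def)
qed

lemma affine_map_id:
  assumes "finite Q" "is_mat_id Q M" "\<And>p. p \<in> Q \<Longrightarrow> t p = 0" "\<And>p. p \<notin> Q \<Longrightarrow> x p = 0"
  shows "affine_map Q M t x = x"
proof
  fix p
  show "affine_map Q M t x p = x p"
  proof (cases "p \<in> Q")
    case True
    have "(\<Sum>q\<in>Q. real_of_int (M p q) * x q) = (\<Sum>q\<in>Q. if p = q then x q else 0)"
      using assms(2) True by (intro sum.cong) (auto simp: is_mat_id_def)
    then show ?thesis using assms True by (simp add: affine_map_def)
  qed (simp add: affine_map_def assms)
qed

lemma unimodular_equiv_refl:
  assumes "finite Q" "\<And>x p. x \<in> S \<Longrightarrow> p \<notin> Q \<Longrightarrow> x p = 0"
  shows "unimodular_equiv Q S S"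
proof -
  define I :: "'a \<Rightarrow> 'a \<Rightarrow> int" where "I p q = (if p = q then 1 else 0)" for p q
  have I: "is_mat_id Q I" by (simp add: is_mat_id_def I_def)
  have "is_mat_id Q (mat_prod Q I I)"
    using I by (simp add: is_mat_id_def mat_prod_id_left[OF assms(1) I])
  moreover have "S = affine_map Q I (\<lambda>_. 0) ` S"
    using affine_map_id[OF assms(1) I] assms(2) by (force simp: image_iff)
  ultimately show ?thesis unfolding unimodular_equiv_iff by blast
qed

lemma unimodular_equiv_sym:
  assumes "finite Q" "\<And>x p. x \<in> S \<Longrightarrow> p \<notin> Q \<Longrightarrow> x p = 0" "unimodular_equiv Q S T"
  shows "unimodular_equiv Q T S"
proof -
  obtain M N t where M: "is_mat_id Q (mat_prod Q M N)" and N: "is_mat_id Q (mat_prod Q N M)"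
    and T: "T = affine_map Q M t ` S"
    using assms(3) unfolding unimodular_equiv_iff by blast
  \<comment> \<open>Solving \<open>y = M x + t\<close> for \<open>x\<close> gives
    \<open>N y - N t\<close>.\<close>
  define s where "s p = - (\<Sum>q\<in>Q. N p q * t q)" for p
  have "affine_map Q N s (affine_map Q M t x) = x" if "x \<in> S" for x
    unfolding affine_map_comp by (rule affine_map_id[OF assms(1) N]) (auto simp: s_def assms(2) that)
  then have "S = affine_map Q N s ` T"
    unfolding T image_image by simp
  then show ?thesis using M N unfolding unimodular_equiv_iff by blast
qed

lemma unimodular_equiv_trans:
  assumes "finite Q" "unimodular_equiv Q S T" "unimodular_equiv Q T R"
  shows "unimodular_equiv Q S R"
proof -
  obtain M N t where M: "is_mat_id Q (mat_prod Q M N)" and N: "is_mat_id Q (mat_prod Q N M)"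
    and T: "T = affine_map Q M t ` S"
    using assms(2) unfolding unimodular_equiv_iff by blast
  obtain M' N' t' where M': "is_mat_id Q (mat_prod Q M' N')" and N': "is_mat_id Q (mat_prod Q N' M')"
    and R: "R = affine_map Q M' t' ` T"
    using assms(3) unfolding unimodular_equiv_iff by blast
  have "R = affine_map Q (mat_prod Q M' M) (\<lambda>p. (\<Sum>q\<in>Q. M' p q * t q) + t' p) ` S"
    unfolding R T image_image affine_map_comp ..
  then show ?thesis
    using is_mat_id_prod[OF assms(1) M M'] is_mat_id_prod[OF assms(1) N' N]
    unfolding unimodular_equiv_iff by blast
qed

text \<open>Only coordinate \<open>p\<close> changes: by a sign, an integer combination of the other
  coordinates and an integer shift. Such a map is invertible over the integers because
  \<open>w p = 0\<close> and \<open>e * e = 1\<close>. As a bijection of the functions vanishing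
  outside \<open>Q\<close>, it only has to match the two memberships pointwise.\<close>

lemma unimodular_equiv_change_coordinate:
  fixes w :: "'a \<Rightarrow> int" and d e :: int
  assumes fin: "finite Q" and p: "p \<in> Q" and e: "e = 1 \<or> e = -1" and wp: "w p = 0"
    and S: "\<And>x q. x \<in> S \<Longrightarrow> q \<notin> Q \<Longrightarrow> x q = 0" and T: "\<And>x q. x \<in> T \<Longrightarrow> q \<notin> Q \<Longrightarrow> x q = 0"
    and ST: "\<And>x. (\<And>q. q \<notin> Q \<Longrightarrow> x q = 0) \<Longrightarrow>
      x \<in> S \<longleftrightarrow> x(p := of_int e * x p + (\<Sum>q\<in>Q. of_int (w q) * x q) + of_int d) \<in> T"
  shows "unimodular_equiv Q S T"
proof -
  define f where "f x = x(p := of_int e * x p + (\<Sum>q\<in>Q. of_int (w q) * x q) + of_int d)"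
    for x :: "'a \<Rightarrow> real"
  define M where "M r q = (if r = p then (if q = p then e else w q) else if r = q then 1 else 0)" for r q
  \<comment> \<open>Row \<open>p\<close> of the inverse: solving for the old value of
    \<open>x p\<close> multiplies by \<open>e\<close>, which is its own inverse.\<close>
  define N where "N r q = (if r = p then (if q = p then e else - e * w q) else if r = q then 1 else 0)" for r q
  define t where "t r = (if r = p then d else 0)" for r
  have ee: "e * e = 1" using e by auto
  have row: "(\<Sum>q\<in>Q. (if r = q then 1 else 0) * g q) = g r" if "r \<in> Q" for r and g :: "'a \<Rightarrow> int"
  proof -
    have "(\<Sum>q\<in>Q. (if r = q then 1 else 0) * g q) = (\<Sum>q\<in>Q. if r = q then g q else 0)"
      by (intro sum.cong) auto
    then show ?thesis using fin that by simp
  qed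
  have col: "(\<Sum>q\<in>Q - {p}. h q * (if q = b then 1 else 0)) = (if b = p then 0 else h b)"
    if "b \<in> Q" for b and h :: "'a \<Rightarrow> int"
  proof -
    have "(\<Sum>q\<in>Q - {p}. h q * (if q = b then 1 else 0)) = (\<Sum>q\<in>Q - {p}. if q = b then h q else 0)"
      by (intro sum.cong) auto
    then show ?thesis using fin that by simp
  qed
  \<comment> \<open>All other rows of \<open>M\<close> and \<open>N\<close> are those of the
    identity, so only row \<open>p\<close> of each product needs computing.\<close>
  have MN: "is_mat_id Q (mat_prod Q M N)"
    unfolding is_mat_id_def
  proof (intro ballI)
    fix a b assume ab: "a \<in> Q" "b \<in> Q"
    show "mat_prod Q M N a b = (if a = b then 1 else 0)"
    proof (cases "a = p")
      case False
      then have "mat_prod Q M N a b = N a b"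
        using row[OF ab(1), of "\<lambda>r. N r b"] by (simp add: mat_prod_def M_def)
      then show ?thesis using False by (simp add: N_def)
    next
      case True
      have "mat_prod Q M N p b = e * N p b + (\<Sum>q\<in>Q - {p}. w q * (if q = b then 1 else 0))"
        unfolding mat_prod_def using fin p by (simp add: sum.remove M_def N_def)
      then show ?thesis using True ee unfolding col[OF ab(2)]
        by (auto simp: N_def mult.assoc[symmetric])
    qed
  qed
  have NM: "is_mat_id Q (mat_prod Q N M)"
    unfolding is_mat_id_def
  proof (intro ballI)
    fix a b assume ab: "a \<in> Q" "b \<in> Q"
    show "mat_prod Q N M a b = (if a = b then 1 else 0)"
    proof (cases "a = p")
      case False
      then have "mat_prod Q N M a b = M a b"
        using row[OF ab(1), of "\<lambda>r. M r b"] by (simp add: mat_prod_def N_def)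
      then show ?thesis using False by (simp add: M_def)
    next
      case True
      have "mat_prod Q N M p b = e * M p b + (\<Sum>q\<in>Q - {p}. (- e * w q) * (if q = b then 1 else 0))"
        unfolding mat_prod_def using fin p by (simp add: sum.remove M_def N_def)
      then show ?thesis using True ee unfolding col[OF ab(2)]
        by (auto simp: M_def)
    qed
  qed
  have f: "affine_map Q M t x = f x" if x: "\<And>q. q \<notin> Q \<Longrightarrow> x q = 0" for x
  proof
    fix r
    show "affine_map Q M t x r = f x r"
    proof (cases "r \<in> Q")
      case False
      then show ?thesis using p x by (auto simp: affine_map_def f_def)
    next
      case True
      show ?thesis
      proof (cases "r = p")
        case False
        have "(\<Sum>q\<in>Q. real_of_int (M r q) * x q) = (\<Sum>q\<in>Q. if r = q then x q else 0)"
          using False by (intro sum.cong) (auto simp: M_def)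
        then show ?thesis using True False fin by (simp add: affine_map_def f_def t_def)
      next
        case eq: True
        show ?thesis using fin p wp
          by (simp add: eq affine_map_def f_def t_def sum.remove M_def)
      qed
    qed
  qed
  have "T = f ` S"
  proof
    show "f ` S \<subseteq> T"
    proof (rule image_subsetI)
      fix x assume "x \<in> S"
      then show "f x \<in> T" using ST[of x] S[of x] unfolding f_def by blast
    qed
    show "T \<subseteq> f ` S"
    proof
      fix y assume y: "y \<in> T"
      \<comment> \<open>The preimage of \<open>y\<close>; the other coordinates stay, and
        \<open>w p = 0\<close> keeps the weighted sum unchanged.\<close>
      define x where "x = y(p := of_int e * (y p - (\<Sum>q\<in>Q. of_int (w q) * y q) - of_int d))"
      have sum: "(\<Sum>q\<in>Q. of_int (w q) * x q) = (\<Sum>q\<in>Q. of_int (w q) * y q)"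
        using wp by (intro sum.cong) (auto simp: x_def)
      have "x p = of_int e * (y p - (\<Sum>q\<in>Q. of_int (w q) * y q) - of_int d)"
        by (simp add: x_def)
      then have "f x = x(p := y p)" unfolding f_def sum using e by auto
      also have "\<dots> = y" by (simp add: x_def)
      finally have "f x = y" .
      moreover have "x q = 0" if "q \<notin> Q" for q using that p T[OF y] by (auto simp: x_def)
      ultimately show "y \<in> f ` S" using ST[of x] y by (auto simp: f_def)
    qed
  qed
  also have "\<dots> = affine_map Q M t ` S" using f S by (intro image_cong) auto
  finally show ?thesis using MN NM unfolding unimodular_equiv_iff by blast
qed

section \<open>Covers and maximal chains\<close>

locale marked =
  fixes P A :: "'a set" and lt :: "'a \<Rightarrow> 'a \<Rightarrow> bool" and lam :: "'a \<Rightarrow> nat"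
  assumes marked_poset: "marked_poset P lt A lam"
begin

lemma finite_P: "finite P"
  and lt_P: "lt x y \<Longrightarrow> x \<in> P \<and> y \<in> P"
  and lt_trans: "lt x y \<Longrightarrow> lt y z \<Longrightarrow> lt x z"
  and A_subset: "A \<subseteq> P"
  and minimal_A: "minimal_el P lt p \<Longrightarrow> p \<in> A"
  and maximal_A: "maximal_el P lt p \<Longrightarrow> p \<in> A"
  using marked_poset unfolding marked_poset_def strict_poset_def by blast+

lemma lt_irrefl: "\<not> lt x x"
  using marked_poset unfolding marked_poset_def strict_poset_def by blast

lemma finite_lt: "finite {(x, y). lt x y}"
  by (rule finite_subset[of _ "P \<times> P"]) (use lt_P finite_P in auto)

lemma acyclic_lt: "acyclic {(x, y). lt x y}"
proof -
  have "trans {(x, y). lt x y}" using lt_trans by (auto simp: trans_def)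
  then show ?thesis using lt_irrefl by (auto simp: acyclic_def trancl_id)
qed

lemma wf_lt: "wf {(x, y). lt x y}"
  by (rule finite_acyclic_wf[OF finite_lt acyclic_lt])

lemma wf_gt: "wf {(x, y). lt y x}"
  using finite_acyclic_wf_converse[OF finite_lt acyclic_lt] by (simp add: converse_unfold)

text \<open>Well-founded descent: while \<open>a\<close> does not cover \<open>p\<close>, replace it
  by an element strictly between.\<close>

lemma ex_upper_cover: "lt p a \<Longrightarrow> \<exists>q. covers P lt p q \<and> (q = a \<or> lt q a)"
proof (induction a rule: wf_induct_rule[OF wf_lt])
  case (1 a)
  show ?case
  proof (cases "covers P lt p a")
    case False
    then obtain r where r: "lt p r" "lt r a" using 1(2) by (auto simp: covers_def)
    then obtain q where "covers P lt p q" "q = r \<or> lt q r" using 1(1)[of r] by auto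
    then show ?thesis using r lt_trans by blast
  qed blast
qed

lemma ex_lower_cover: "lt p a \<Longrightarrow> \<exists>q. covers P lt q a \<and> (q = p \<or> lt p q)"
proof (induction p rule: wf_induct_rule[OF wf_gt])
  case (1 p)
  show ?case
  proof (cases "covers P lt p a")
    case False
    then obtain r where r: "lt p r" "lt r a" using 1(2) by (auto simp: covers_def)
    then obtain q where "covers P lt q a" "q = r \<or> lt r q" using 1(1)[of r] by auto
    then show ?thesis using r lt_trans by blast
  qed blast
qed

lemma ex_marked_below:
  assumes "p \<in> P - A"
  shows "\<exists>b\<in>A. lt b p"
proof -
  have "p \<in> P \<Longrightarrow> p \<in> A \<or> (\<exists>b\<in>A. lt b p)"
  proof (induction p rule: wf_induct_rule[OF wf_lt])
    case (1 p)
    show ?case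
    proof (cases "minimal_el P lt p")
      case False
      then obtain q where "q \<in> P" "lt q p" using 1 by (auto simp: minimal_el_def)
      then show ?thesis using 1(1)[of q] lt_trans[of _ q p] by auto
    qed (use minimal_A in auto)
  qed
  then show ?thesis using assms by blast
qed

text \<open>Any element above \<open>p\<close> is a cover of \<open>p\<close> or lies above one, so
  a single cover is least among all elements above \<open>p\<close>. A cover exists because an
  unmarked element is not maximal.\<close>

lemma unique_cover_least_above:
  assumes p: "p \<in> P - A" and card: "card (covering_set P lt p) < 2"
  obtains q where "lt p q" "\<And>a. lt p a \<Longrightarrow> a = q \<or> lt q a"
proof -
  \<comment> \<open>An infinite set has \<open>card\<close> 0, so the bound on \<open>card\<close>
    excludes two covers only together with finiteness.\<close>
  have fin: "finite (covering_set P lt p)" using finite_P by (simp add: covering_set_def)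
  obtain a where "lt p a" using p maximal_A[of p] by (auto simp: maximal_el_def)
  then obtain q where q: "covers P lt p q" using ex_upper_cover by blast
  have mem: "r \<in> covering_set P lt p" if "covers P lt p r" for r
    using that lt_P by (auto simp: covering_set_def covers_def)
  have uniq: "r = q" if "covers P lt p r" for r
  proof (rule ccontr)
    assume "r \<noteq> q"
    then have "card {r, q} = 2" by simp
    moreover have "card {r, q} \<le> card (covering_set P lt p)"
      using mem q that fin by (intro card_mono) auto
    ultimately show False using card by simp
  qed
  show thesis
  proof
    show "lt p q" using q by (simp add: covers_def)
    show "a = q \<or> lt q a" if "lt p a" for a using ex_upper_cover[OF that] uniq by blast
  qed
qed

section \<open>Maximal chains ending in a given element\<close>

lemma sorted_wrt_distinct:
  assumes "sorted_wrt lt cs"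
  shows "distinct cs"
  using assms lt_irrefl by (induction cs) auto

lemma max_chain_sorted:
  assumes "cs \<in> max_chains_to P lt p"
  shows "sorted_wrt lt cs"
proof -
  have "successively lt cs"
    using assms successively_mono[of "covers P lt" cs lt] by (simp add: max_chains_to_def covers_def)
  moreover have "transp lt" using lt_trans by (rule transpI)
  ultimately show ?thesis by (simp add: successively_conv_sorted_wrt)
qed

lemma max_chain_extend:
  assumes "cs \<in> max_chains_to P lt q" "covers P lt q p"
  shows "cs @ [p] \<in> max_chains_to P lt p"
  using assms by (auto simp: max_chains_to_def successively_append_iff)

lemma ex_max_chain:
  "p \<in> P \<Longrightarrow> \<exists>cs. cs \<in> max_chains_to P lt p"
proof (induction p rule: wf_induct_rule[OF wf_lt])
  case (1 p)
  show ?case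
  proof (cases "minimal_el P lt p")
    case True
    then have "[p] \<in> max_chains_to P lt p" by (simp add: max_chains_to_def)
    then show ?thesis by blast
  next
    case False
    then obtain r where "lt r p" using 1 by (auto simp: minimal_el_def)
    then obtain q where q: "covers P lt q p" using ex_lower_cover by blast
    then have "lt q p" by (simp add: covers_def)
    then show ?thesis using 1 q max_chain_extend lt_P by blast
  qed
qed

text \<open>Induction through a lower cover of \<open>p\<close> that is still equal to or above
  \<open>r\<close>; the chain found there is extended by \<open>p\<close>.\<close>

lemma ex_max_chain_through:
  "lt r p \<Longrightarrow> \<exists>cs. cs \<in> max_chains_to P lt p \<and> r \<in> set cs"
proof (induction p rule: wf_induct_rule[OF wf_lt])
  case (1 p)
  obtain q where q: "covers P lt q p" "q = r \<or> lt r q" using ex_lower_cover[OF 1(2)] by blast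
  then have "lt q p" by (simp add: covers_def)
  have "\<exists>cs. cs \<in> max_chains_to P lt q \<and> r \<in> set cs"
  proof (cases "q = r")
    case True
    obtain cs where "cs \<in> max_chains_to P lt r" using ex_max_chain lt_P 1 by blast
    moreover from this have "r \<in> set cs" by (auto simp: max_chains_to_def)
    ultimately show ?thesis using True by blast
  qed (use 1 q \<open>lt q p\<close> in auto)
  then obtain cs where "cs \<in> max_chains_to P lt q" "r \<in> set cs" by blast
  then show ?case using max_chain_extend[OF _ q(1)] by (intro exI[of _ "cs @ [p]"]) auto
qed

lemma set_max_chain: "cs \<in> max_chains_to P lt p \<Longrightarrow> p \<in> P \<Longrightarrow> set cs \<subseteq> P"
proof
  fix x assume cs: "cs \<in> max_chains_to P lt p" "p \<in> P" "x \<in> set cs"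
  show "x \<in> P"
  proof (cases "cs = [x]")
    case True
    then show ?thesis using cs by (auto simp: max_chains_to_def)
  next
    case False
    obtain ys zs where "cs = ys @ x # zs" using cs by (meson split_list)
    with False max_chain_sorted[OF cs(1)] show ?thesis
      using lt_P by (cases ys; cases zs) (auto simp: sorted_wrt_append)
  qed
qed

lemma finite_max_chains: "p \<in> P \<Longrightarrow> finite (max_chains_to P lt p)"
  by (rule finite_subset[OF _ finite_subset_distinct[OF finite_P]])
    (use set_max_chain max_chain_sorted sorted_wrt_distinct in blast)

text \<open>Each of \<open>r\<close> and \<open>s\<close> lies on a maximal chain ending in
  \<open>p\<close>; these chains coincide, and their positions in it compare the two.\<close>

lemma unique_max_chain_total_below:
  assumes p: "p \<in> P" and card: "card (max_chains_to P lt p) < 2" and "lt r p" "lt s p"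
  shows "r = s \<or> lt r s \<or> lt s r"
proof -
  obtain cs ds where cs: "cs \<in> max_chains_to P lt p" "r \<in> set cs"
    and ds: "ds \<in> max_chains_to P lt p" "s \<in> set ds"
    using ex_max_chain_through assms by blast
  have "cs = ds"
  proof (rule ccontr)
    assume "cs \<noteq> ds"
    then have "card {cs, ds} = 2" by simp
    moreover have "card {cs, ds} \<le> card (max_chains_to P lt p)"
      using cs ds finite_max_chains[OF p] by (intro card_mono) auto
    ultimately show False using card by simp
  qed
  then obtain i j where "i < length cs" "r = cs ! i" "j < length cs" "s = cs ! j"
    using cs ds by (metis in_set_conv_nth)
  then show ?thesis
    using max_chain_sorted[OF cs(1)]
    by (cases i j rule: linorder_cases) (auto simp: sorted_wrt_iff_nth_less)
qed

section \<open>The polytope in terms of chains as sets\<close>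

definition chain_set :: "'a set \<Rightarrow> bool" where
  "chain_set C \<longleftrightarrow> (\<forall>u\<in>C. \<forall>v\<in>C. u = v \<or> lt u v \<or> lt v u)"

text \<open>The lower end is always marked, since admissibility puts no element of the order part
  below one of the chain part. \<open>C\<close> may be empty; \<open>lt b a\<close> is stated
  separately for that case, where the chain inequality reads \<lambda>_b \<le> x_a.\<close>

definition chain_between :: "'a set \<Rightarrow> 'a \<Rightarrow> 'a \<Rightarrow> 'a set \<Rightarrow> bool" where
  "chain_between U a b C \<longleftrightarrow>
     b \<in> A \<and> lt b a \<and> C \<subseteq> U \<and> chain_set C \<and> (\<forall>c\<in>C. lt b c \<and> lt c a)"

lemma ex_sorted_chain:
  assumes "finite C" "chain_set C"
  shows "\<exists>cs. set cs = C \<and> sorted_wrt (\<lambda>u v. lt v u) cs"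
  using assms
proof (induction C rule: finite_psubset_induct)
  case (psubset C)
  show ?case
  proof (cases "C = {}")
    case False
    then obtain m where m: "m \<in> C" "\<And>c. c \<in> C \<Longrightarrow> \<not> lt m c"
      using wfE_min[OF wf_gt, of _ C] by (metis (no_types, lifting) all_not_in_conv case_prodI mem_Collect_eq)
    have "chain_set (C - {m})" using psubset.prems by (auto simp: chain_set_def)
    then obtain cs where cs: "set cs = C - {m}" "sorted_wrt (\<lambda>u v. lt v u) cs"
      using psubset.IH[of "C - {m}"] m by blast
    have "sorted_wrt (\<lambda>u v. lt v u) (m # cs)"
      using cs m psubset.prems by (auto simp: chain_set_def)
    then show ?thesis using cs m by (intro exI[of _ "m # cs"]) auto
  qed auto
qed

text \<open>Conditions (i) and (iii) merge into one, and (ii) becomes the case \<open>C = {}\<close>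
  of the chain condition. The guard \<open>a \<in> U1 \<or> C \<noteq> {}\<close> keeps that case
  from comparing two marks with each other, which the polytope does not do. Chains become sets
  because strictly monotone lists have distinct entries.\<close>

lemma mem_polytope_iff:
  assumes adm: "admissible_decomp P lt A U1 U2"
  shows "x \<in> chain_order_polytope P lt A lam U1 U2 \<longleftrightarrow>
     (\<forall>q. q \<notin> P - A \<longrightarrow> x q = 0)
   \<and> (\<forall>u\<in>U1. \<forall>a\<in>A \<union> U1. lt u a \<longrightarrow> x u \<le> lamx A lam x a)
   \<and> (\<forall>u\<in>U2. 0 \<le> x u)
   \<and> (\<forall>a\<in>A \<union> U1. \<forall>b C. chain_between U2 a b C \<longrightarrow> a \<in> U1 \<or> C \<noteq> {} \<longrightarrow>
        real (lam b) + sum x C \<le> lamx A lam x a)"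
    (is "_ \<longleftrightarrow> ?V \<and> ?U \<and> ?N \<and> ?C")
proof -
  have U: "U1 \<inter> U2 = {}" "U1 \<inter> A = {}" "U1 \<subseteq> P" "U2 \<subseteq> P - A"
    and U12: "\<And>u v. u \<in> U1 \<Longrightarrow> v \<in> U2 \<Longrightarrow> \<not> lt u v"
    using adm unfolding admissible_decomp_def by auto
  have lamA: "lamx A lam x a = real (lam a)" if "a \<in> A" for a using that by (simp add: lamx_def)
  have lamU: "lamx A lam x u = x u" if "u \<in> U1" for u using that U by (auto simp: lamx_def)
  have sum_conv: "sum_list (map x cs) = sum x (set cs)"
    if "sorted_wrt lt cs \<or> sorted_wrt (\<lambda>u v. lt v u) cs" for cs
  proof -
    have "distinct cs"
      using that sorted_wrt_distinct[of cs] sorted_wrt_distinct[of "rev cs"]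
      by (auto simp: sorted_wrt_rev)
    then show ?thesis by (rule sum_list_distinct_conv_sum_set)
  qed
  show ?thesis
  proof
    assume x: "x \<in> chain_order_polytope P lt A lam U1 U2"
    note D = x[unfolded chain_order_polytope_def mem_Collect_eq]
    note D1 = D[THEN conjunct2] note D2 = D1[THEN conjunct2] note D3 = D2[THEN conjunct2]
    note D4 = D3[THEN conjunct2] note D5 = D4[THEN conjunct2]
    have ?V by (rule D[THEN conjunct1])
    moreover have ?U using D1[THEN conjunct1] D3[THEN conjunct1] lamA lamU by auto
    moreover have ?N by (rule D4[THEN conjunct1])
    moreover have ?C
    proof (intro ballI allI impI)
      fix a b C assume a: "a \<in> A \<union> U1" and C: "chain_between U2 a b C" and ne: "a \<in> U1 \<or> C \<noteq> {}"
      show "real (lam b) + sum x C \<le> lamx A lam x a"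
      proof (cases "C = {}")
        case True
        then show ?thesis
          using D2[THEN conjunct1] C ne lamU unfolding chain_between_def by auto
      next
        case False
        have "finite C" using C U finite_P unfolding chain_between_def by (meson Diff_subset finite_subset subset_trans)
        then obtain cs where cs: "set cs = C" "sorted_wrt (\<lambda>u v. lt v u) cs"
          using ex_sorted_chain C unfolding chain_between_def by blast
        then have "cs \<noteq> []" using False by auto
        then have "hd cs \<in> C" "last cs \<in> C" using cs by auto
        then have "lt b (last cs)" "lt (hd cs) a" "b \<in> A" "set cs \<subseteq> U2"
          using C cs unfolding chain_between_def by auto
        then have "sum_list (map x cs) \<le> lamx A lam x a - lamx A lam x b"
          using D5[THEN conjunct1, rule_format, of a b cs] a cs \<open>cs \<noteq> []\<close> by blast
        then show ?thesis using cs sum_conv lamA \<open>b \<in> A\<close> by auto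
      qed
    qed
    ultimately show "?V \<and> ?U \<and> ?N \<and> ?C" by blast
  next
    assume R: "?V \<and> ?U \<and> ?N \<and> ?C"
    have V: ?V and UU: ?U and N: ?N using R by blast+
    have C: "real (lam b) + sum x C \<le> lamx A lam x a"
      if "a \<in> A \<union> U1" "chain_between U2 a b C" "a \<in> U1 \<or> C \<noteq> {}" for a b C
      using that R by blast
    have 1: "\<forall>p\<in>U1. \<forall>a\<in>A. lt p a \<longrightarrow> x p \<le> real (lam a)"
      using UU lamA by (metis UnCI)
    have 2: "\<forall>q\<in>U1. \<forall>b\<in>A. lt b q \<longrightarrow> real (lam b) \<le> x q"
    proof (intro ballI impI)
      fix q b assume "q \<in> U1" "b \<in> A" "lt b q"
      then show "real (lam b) \<le> x q"
        using C[of q b "{}"] lamU by (simp add: chain_between_def chain_set_def)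
    qed
    have 3: "\<forall>p\<in>U1. \<forall>q\<in>U1. lt p q \<longrightarrow> x p \<le> x q"
      using UU lamU by (metis UnCI)
    have 4: "sum_list (map x cs) \<le> lamx A lam x a - lamx A lam x b"
      if "a \<in> A \<union> U1" "b \<in> A \<union> U1" "cs \<noteq> []" "set cs \<subseteq> U2" "sorted_wrt (\<lambda>u v. lt v u) cs"
        "lt b (last cs)" "lt (hd cs) a" for a b cs
    proof -
      have b: "b \<in> A" using that U12[of b "last cs"] last_in_set[of cs] by blast
      have hd: "c = hd cs \<or> lt c (hd cs)" if "c \<in> set cs" for c
        using \<open>sorted_wrt _ cs\<close> that by (cases cs) auto
      have la: "c = last cs \<or> lt (last cs) c" if "c \<in> set cs" for c
        using \<open>sorted_wrt _ cs\<close> that by (cases cs rule: rev_cases) (auto simp: sorted_wrt_append)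
      have "chain_set (set cs)"
        unfolding chain_set_def
      proof (intro ballI)
        fix u v assume "u \<in> set cs" "v \<in> set cs"
        then obtain i j where "i < length cs" "u = cs ! i" "j < length cs" "v = cs ! j"
          by (metis in_set_conv_nth)
        then show "u = v \<or> lt u v \<or> lt v u"
          using that(5) by (cases i j rule: linorder_cases) (auto simp: sorted_wrt_iff_nth_less)
      qed
      moreover have bet: "lt b c \<and> lt c a" if "c \<in> set cs" for c
        using hd[OF that] la[OF that] \<open>lt b (last cs)\<close> \<open>lt (hd cs) a\<close> lt_trans by metis
      moreover have "lt b a" using bet[of "hd cs"] that(3) lt_trans by (meson hd_in_set)
      ultimately have "chain_between U2 a b (set cs)"
        using b that unfolding chain_between_def by blast
      then show ?thesis using C[of a b "set cs"] that lamA[OF b] sum_conv[of cs] by auto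
    qed
    \<comment> \<open>Condition (vi) follows from (v): below every chain lies a minimal, hence marked, element.\<close>
    have 5: "sum_list (map x cs) \<le> x q"
      if q: "q \<in> U1" and cs: "cs \<noteq> []" "set cs \<subseteq> U2" "sorted_wrt lt cs" "lt (last cs) q" for q cs
    proof -
      have "hd cs \<in> P - A" using cs U hd_in_set by blast
      then obtain b where b: "b \<in> A" "lt b (hd cs)" using ex_marked_below by blast
      have "sum_list (map x (rev cs)) \<le> lamx A lam x q - lamx A lam x b"
        by (rule 4) (use q cs b in \<open>auto simp: sorted_wrt_rev hd_rev last_rev\<close>)
      moreover have "sum_list (map x (rev cs)) = sum_list (map x cs)"
        using sum_conv[of cs] sum_conv[of "rev cs"] cs by (simp add: sorted_wrt_rev)
      ultimately show ?thesis using lamA[OF b(1)] lamU[OF q] by simp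
    qed
    show "x \<in> chain_order_polytope P lt A lam U1 U2"
      unfolding chain_order_polytope_def mem_Collect_eq
      by (intro conjI V 1 2 3 N ballI allI impI 4 5; elim conjE; assumption)
  qed
qed

section \<open>Moving one element between the two parts\<close>

text \<open>The inequalities common to the two polytopes compared below: there \<open>p\<close> lies
  in none of \<open>A\<close>, \<open>W\<close> and \<open>X\<close>, so coordinate \<open>p\<close>
  occurs in none of them.\<close>

definition free_conditions :: "'a set \<Rightarrow> 'a set \<Rightarrow> ('a \<Rightarrow> real) \<Rightarrow> bool" where
  "free_conditions W X x \<longleftrightarrow>
     (\<forall>q. q \<notin> P - A \<longrightarrow> x q = 0)
   \<and> (\<forall>u\<in>W. \<forall>a\<in>A \<union> W. lt u a \<longrightarrow> x u \<le> lamx A lam x a)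
   \<and> (\<forall>u\<in>X. 0 \<le> x u)
   \<and> (\<forall>a\<in>A \<union> W. \<forall>b C. chain_between X a b C \<longrightarrow> a \<in> W \<or> C \<noteq> {} \<longrightarrow>
        real (lam b) + sum x C \<le> lamx A lam x a)"

text \<open>The threshold \<open>t\<close> is left free: it is \<open>x p\<close> when
  \<open>p\<close> belongs to the order part, and a chain sum plus \<open>x p\<close> when it
  belongs to the chain part.\<close>

definition upper_bound :: "'a set \<Rightarrow> 'a \<Rightarrow> ('a \<Rightarrow> real) \<Rightarrow> real \<Rightarrow> bool" where
  "upper_bound W p x t \<longleftrightarrow> (\<forall>a\<in>A \<union> W. lt p a \<longrightarrow> t \<le> lamx A lam x a)"

definition lower_bound :: "'a set \<Rightarrow> 'a \<Rightarrow> ('a \<Rightarrow> real) \<Rightarrow> real \<Rightarrow> bool" where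
  "lower_bound X p x t \<longleftrightarrow> (\<forall>b C. chain_between X p b C \<longrightarrow> real (lam b) + sum x C \<le> t)"

end

text \<open>Admissibility on both sides of the move places \<open>p\<close> at the border: nothing
  in \<open>W\<close> lies below \<open>p\<close> and nothing in \<open>X\<close> lies above
  it.\<close>

locale move_element = marked P A lt lam
  for P A :: "'a set" and lt :: "'a \<Rightarrow> 'a \<Rightarrow> bool" and lam :: "'a \<Rightarrow> nat" +
  fixes p :: 'a and W X :: "'a set"
  assumes admU: "admissible_decomp P lt A (insert p W) X"
    and admV: "admissible_decomp P lt A W (insert p X)"
begin

lemma p_mem: "p \<in> P" "p \<notin> A" "p \<notin> W" "p \<notin> X"
  and W_subset: "W \<subseteq> P - A" and X_subset: "X \<subseteq> P - A"
  and cover_P: "insert p (W \<union> X) = P - A"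
  using admU admV unfolding admissible_decomp_def by auto

lemma no_lt: "u \<in> insert p W \<Longrightarrow> v \<in> X \<Longrightarrow> \<not> lt u v" "u \<in> W \<Longrightarrow> \<not> lt u p"
  using admU admV unfolding admissible_decomp_def by blast+

lemma lamx_p: "lamx A lam x p = x p"
  using p_mem by (simp add: lamx_def)

lemma lamx_upd: "a \<noteq> p \<Longrightarrow> lamx A lam (x(p := v)) a = lamx A lam x a"
  by (simp add: lamx_def)

lemma sum_upd: "p \<notin> C \<Longrightarrow> sum (x(p := v)) C = sum x C"
  by (intro sum.cong) auto

lemma chain_between_p: "chain_between X a b C \<Longrightarrow> p \<notin> C"
  using p_mem unfolding chain_between_def by blast

lemma free_conditions_upd: "free_conditions W X (x(p := v)) = free_conditions W X x"
proof -
  have lam: "lamx A lam (x(p := v)) a = lamx A lam x a" if "a \<in> A \<union> W" for a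
    using that p_mem by (intro lamx_upd) auto
  have 1: "(\<forall>q. q \<notin> P - A \<longrightarrow> (x(p := v)) q = 0) \<longleftrightarrow> (\<forall>q. q \<notin> P - A \<longrightarrow> x q = 0)"
    using p_mem by auto
  have 2: "(\<forall>u\<in>W. \<forall>a\<in>A \<union> W. lt u a \<longrightarrow> (x(p := v)) u \<le> lamx A lam (x(p := v)) a) \<longleftrightarrow>
      (\<forall>u\<in>W. \<forall>a\<in>A \<union> W. lt u a \<longrightarrow> x u \<le> lamx A lam x a)"
    by (intro ball_cong refl) (use lam p_mem in auto)
  have 3: "(\<forall>u\<in>X. 0 \<le> (x(p := v)) u) \<longleftrightarrow> (\<forall>u\<in>X. 0 \<le> x u)"
    using p_mem by auto
  have 4: "(\<forall>a\<in>A \<union> W. \<forall>b C. chain_between X a b C \<longrightarrow> a \<in> W \<or> C \<noteq> {} \<longrightarrow>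
        real (lam b) + sum (x(p := v)) C \<le> lamx A lam (x(p := v)) a) \<longleftrightarrow>
      (\<forall>a\<in>A \<union> W. \<forall>b C. chain_between X a b C \<longrightarrow> a \<in> W \<or> C \<noteq> {} \<longrightarrow>
        real (lam b) + sum x C \<le> lamx A lam x a)"
    by (intro ball_cong refl all_cong1 imp_cong)
      (simp only: lam sum_upd[OF chain_between_p])
  show ?thesis unfolding free_conditions_def 1 2 3 4 ..
qed

lemma upper_bound_upd: "upper_bound W p (x(p := v)) t = upper_bound W p x t"
proof -
  have "a \<noteq> p" if "a \<in> A \<union> W" for a using that p_mem by auto
  then show ?thesis unfolding upper_bound_def by (intro ball_cong refl) (simp add: lamx_upd)
qed

text \<open>As an order element, \<open>p\<close> is bounded above by the values over it and below
  by the chains ending in it. It is never an upper end for an element of \<open>W\<close>, since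
  none lies below \<open>p\<close>.\<close>

lemma mem_U_iff:
  "x \<in> chain_order_polytope P lt A lam (insert p W) X \<longleftrightarrow>
     free_conditions W X x \<and> upper_bound W p x (x p) \<and> lower_bound X p x (x p)"
proof -
  have 1: "(\<forall>u\<in>insert p W. \<forall>a\<in>A \<union> insert p W. lt u a \<longrightarrow> x u \<le> lamx A lam x a) \<longleftrightarrow>
     (\<forall>u\<in>W. \<forall>a\<in>A \<union> W. lt u a \<longrightarrow> x u \<le> lamx A lam x a) \<and> upper_bound W p x (x p)"
    unfolding upper_bound_def using no_lt(2) lt_irrefl by auto
  have 2: "(\<forall>a\<in>A \<union> insert p W. \<forall>b C. chain_between X a b C \<longrightarrow> a \<in> insert p W \<or> C \<noteq> {} \<longrightarrow>
        real (lam b) + sum x C \<le> lamx A lam x a) \<longleftrightarrow>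
     (\<forall>a\<in>A \<union> W. \<forall>b C. chain_between X a b C \<longrightarrow> a \<in> W \<or> C \<noteq> {} \<longrightarrow>
        real (lam b) + sum x C \<le> lamx A lam x a) \<and> lower_bound X p x (x p)"
    unfolding lower_bound_def lamx_p[of x, symmetric] by blast
  show ?thesis
    unfolding mem_polytope_iff[OF admU] free_conditions_def 1 2 by blast
qed

text \<open>A chain in \<open>insert p X\<close> either avoids \<open>p\<close> and gives a common
  condition, or has \<open>p\<close> as its top, since nothing in \<open>X\<close> lies above
  \<open>p\<close>. In the second case it splits into a chain in \<open>X\<close> ending below
  \<open>p\<close> and an arbitrary upper end above \<open>p\<close>.\<close>

lemma mem_V_iff:
  "x \<in> chain_order_polytope P lt A lam W (insert p X) \<longleftrightarrow>
     free_conditions W X x \<and> 0 \<le> x p \<and>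
     (\<forall>b C. chain_between X p b C \<longrightarrow> upper_bound W p x (real (lam b) + sum x C + x p))"
proof -
  have without: "chain_between (insert p X) a b C \<longleftrightarrow> chain_between X a b C" if "p \<notin> C" for a b C
    using that unfolding chain_between_def by blast
  have with_p: "chain_between (insert p X) a b (insert p C) \<longleftrightarrow> lt p a \<and> chain_between X p b C"
    if "p \<notin> C" for a b C
  proof
    assume ch: "chain_between (insert p X) a b (insert p C)"
    then have C: "C \<subseteq> X" using that unfolding chain_between_def by blast
    have "lt c p" if "c \<in> C" for c
    proof -
      have "c \<noteq> p" "c \<in> X" using that C p_mem by auto
      then show ?thesis
        using ch that no_lt(1)[of p c] unfolding chain_between_def chain_set_def by auto
    qed
    then show "lt p a \<and> chain_between X p b C"
      using ch C unfolding chain_between_def chain_set_def by auto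
  next
    assume ch: "lt p a \<and> chain_between X p b C"
    moreover from this have "lt c a" if "c \<in> C" for c
      using that lt_trans[of c p a] by (simp add: chain_between_def)
    moreover have "lt b a" using ch lt_trans[of b p a] by (simp add: chain_between_def)
    ultimately show "chain_between (insert p X) a b (insert p C)"
      unfolding chain_between_def chain_set_def by auto
  qed
  have sum_p: "sum x (insert p C) = x p + sum x C" if "p \<notin> C" "C \<subseteq> X" for C
    using that X_subset finite_P by (meson Diff_subset finite_subset sum.insert)
  have 1: "(\<forall>a\<in>A \<union> W. \<forall>b C. chain_between (insert p X) a b C \<longrightarrow> a \<in> W \<or> C \<noteq> {} \<longrightarrow>
        real (lam b) + sum x C \<le> lamx A lam x a) \<longleftrightarrow>
     (\<forall>a\<in>A \<union> W. \<forall>b C. chain_between X a b C \<longrightarrow> a \<in> W \<or> C \<noteq> {} \<longrightarrow>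
        real (lam b) + sum x C \<le> lamx A lam x a) \<and>
     (\<forall>b C. chain_between X p b C \<longrightarrow> upper_bound W p x (real (lam b) + sum x C + x p))"
    (is "?L \<longleftrightarrow> ?R1 \<and> ?R2")
  proof
    assume L: ?L
    have ?R1 using L without chain_between_p by meson
    moreover have ?R2
      unfolding upper_bound_def
    proof (intro allI ballI impI)
      fix b C a assume C: "chain_between X p b C" and a: "a \<in> A \<union> W" "lt p a"
      have "p \<notin> C" using C by (rule chain_between_p)
      then have "real (lam b) + sum x (insert p C) \<le> lamx A lam x a"
        using L a C with_p by (meson insert_not_empty)
      then show "real (lam b) + sum x C + x p \<le> lamx A lam x a"
        using sum_p[of C] \<open>p \<notin> C\<close> C unfolding chain_between_def by auto
    qed
    ultimately show "?R1 \<and> ?R2" ..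
  next
    assume R: "?R1 \<and> ?R2"
    show ?L
    proof (intro ballI allI impI)
      fix a b C assume a: "a \<in> A \<union> W" and C: "chain_between (insert p X) a b C" "a \<in> W \<or> C \<noteq> {}"
      show "real (lam b) + sum x C \<le> lamx A lam x a"
      proof (cases "p \<in> C")
        case False
        then show ?thesis using R a C without by blast
      next
        case True
        then obtain D where D: "C = insert p D" "p \<notin> D" by (meson Set.set_insert)
        then have "lt p a" "chain_between X p b D" using C with_p by auto
        then have "real (lam b) + sum x D + x p \<le> lamx A lam x a"
          using R a unfolding upper_bound_def by blast
        then show ?thesis
          using D sum_p[of D] \<open>chain_between X p b D\<close> unfolding chain_between_def by auto
      qed
    qed
  qed
  have 2: "(\<forall>u\<in>insert p X. 0 \<le> x u) \<longleftrightarrow> 0 \<le> x p \<and> (\<forall>u\<in>X. 0 \<le> x u)" by simp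
  show ?thesis
    unfolding mem_polytope_iff[OF admV] free_conditions_def 1 2 by blast
qed

section \<open>Reflection and translation of the coordinate of the moved element\<close>

lemma polytope_vanish:
  "x \<in> chain_order_polytope P lt A lam U V \<Longrightarrow> q \<notin> P - A \<Longrightarrow> x q = 0"
  unfolding chain_order_polytope_def by simp

lemma finite_PA: "finite (P - A)"
  using finite_P by simp

lemma p_PA: "p \<in> P - A"
  using p_mem by simp

text \<open>With \<open>g\<close> the tightest upper bound, the reflection
  \<open>x p \<mapsto> g - x p\<close> exchanges the two kinds of conditions:
  \<open>x p \<le> g\<close> becomes nonnegativity of the new coordinate \<open>y p\<close>, and
  \<open>l \<le> x p\<close> becomes \<open>l + y p \<le> g\<close>. By \<open>w p = 0\<close>,
  \<open>g\<close> does not depend on \<open>x p\<close>.\<close>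

lemma equiv_if_greatest_upper_bound:
  fixes w :: "'a \<Rightarrow> int" and d :: int
  assumes wp: "w p = 0"
    and bound: "\<And>x t. free_conditions W X x \<Longrightarrow>
      upper_bound W p x t \<longleftrightarrow> t \<le> (\<Sum>q\<in>P - A. of_int (w q) * x q) + of_int d"
  shows "unimodular_equiv (P - A) (chain_order_polytope P lt A lam (insert p W) X)
                                  (chain_order_polytope P lt A lam W (insert p X))"
proof (rule unimodular_equiv_change_coordinate[OF finite_PA p_PA, where e = "-1" and w = w and d = d])
  fix x :: "'a \<Rightarrow> real"
  define g where "g = (\<Sum>q\<in>P - A. of_int (w q) * x q) + of_int d"
  define y where "y = x(p := of_int (-1) * x p + (\<Sum>q\<in>P - A. of_int (w q) * x q) + of_int d)"
  have y: "y = x(p := g - x p)" unfolding y_def g_def by (simp add: algebra_simps)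
  have sum_y: "sum y C = sum x C" if "chain_between X p b C" for b C
    unfolding y by (rule sum_upd[OF chain_between_p[OF that]])
  show "(x \<in> chain_order_polytope P lt A lam (insert p W) X) =
        (y \<in> chain_order_polytope P lt A lam W (insert p X))"
  proof (cases "free_conditions W X x")
    case True
    have ub: "upper_bound W p x t \<longleftrightarrow> t \<le> g" for t using bound[OF True] by (simp add: g_def)
    have "(\<forall>b C. chain_between X p b C \<longrightarrow> upper_bound W p y (real (lam b) + sum y C + y p))
       \<longleftrightarrow> lower_bound X p x (x p)"
      unfolding lower_bound_def using sum_y by (auto simp: y upper_bound_upd ub simp del: fun_upd_apply)
        (auto simp: algebra_simps)
    moreover have "0 \<le> y p \<longleftrightarrow> upper_bound W p x (x p)" by (simp add: ub y)
    ultimately show ?thesis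
      unfolding mem_U_iff mem_V_iff by (auto simp: y free_conditions_upd simp del: fun_upd_apply)
  qed (simp add: mem_U_iff mem_V_iff y free_conditions_upd del: fun_upd_apply)
qed (use wp polytope_vanish in auto)

text \<open>With \<open>g\<close> the largest lower expression, the shift
  \<open>x p \<mapsto> x p - g\<close> turns \<open>g \<le> x p\<close> into nonnegativity. The
  inequalities \<open>l + x p - g \<le> h\<close> need testing only at \<open>l = g\<close>, where
  they read \<open>x p \<le> h\<close>.\<close>

lemma equiv_if_least_lower_bound:
  fixes w :: "'a \<Rightarrow> int" and d :: int
  assumes wp: "w p = 0"
    and bound: "\<And>x t. free_conditions W X x \<Longrightarrow>
      lower_bound X p x t \<longleftrightarrow> (\<Sum>q\<in>P - A. of_int (w q) * x q) + of_int d \<le> t"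
  shows "unimodular_equiv (P - A) (chain_order_polytope P lt A lam (insert p W) X)
                                  (chain_order_polytope P lt A lam W (insert p X))"
proof (rule unimodular_equiv_change_coordinate[OF finite_PA p_PA,
      where e = 1 and w = "\<lambda>q. - w q" and d = "- d"])
  fix x :: "'a \<Rightarrow> real"
  define g where "g = (\<Sum>q\<in>P - A. of_int (w q) * x q) + of_int d"
  define y where "y = x(p := of_int 1 * x p + (\<Sum>q\<in>P - A. of_int (- w q) * x q) + of_int (- d))"
  have y: "y = x(p := x p - g)" unfolding y_def g_def by (simp add: algebra_simps sum_negf)
  have sum_y: "sum y C = sum x C" if "chain_between X p b C" for b C
    unfolding y by (rule sum_upd[OF chain_between_p[OF that]])
  show "(x \<in> chain_order_polytope P lt A lam (insert p W) X) =
        (y \<in> chain_order_polytope P lt A lam W (insert p X))"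
  proof (cases "free_conditions W X x")
    case True
    have lb: "lower_bound X p x t \<longleftrightarrow> g \<le> t" for t using bound[OF True] by (simp add: g_def)
    have "(\<forall>b C. chain_between X p b C \<longrightarrow> upper_bound W p y (real (lam b) + sum y C + y p))
       \<longleftrightarrow> (\<forall>b C. chain_between X p b C \<longrightarrow>
             (\<forall>a\<in>A \<union> W. lt p a \<longrightarrow> real (lam b) + sum x C + (x p - g) \<le> lamx A lam x a))"
      using sum_y by (simp add: y upper_bound_upd) (simp add: upper_bound_def)
    \<comment> \<open>Exchanging the quantifiers: for a fixed upper end \<open>a\<close>, the
      inequalities over all chains form a single lower bound condition, to which \<open>lb\<close>
      applies.\<close>
    also have "\<dots> \<longleftrightarrow> (\<forall>a\<in>A \<union> W. lt p a \<longrightarrow> lower_bound X p x (lamx A lam x a - x p + g))"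
      unfolding lower_bound_def by (auto simp: algebra_simps)
    also have "\<dots> \<longleftrightarrow> upper_bound W p x (x p)"
      unfolding lb upper_bound_def by auto
    finally show ?thesis
      unfolding mem_U_iff mem_V_iff by (auto simp: y free_conditions_upd lb)
  qed (simp add: mem_U_iff mem_V_iff y free_conditions_upd del: fun_upd_apply)
qed (use wp polytope_vanish in auto)

section \<open>The two ways of not being a star element\<close>

lemma sum_indicator_weight:
  fixes x :: "'a \<Rightarrow> real"
  assumes "C \<subseteq> P - A"
  shows "(\<Sum>q\<in>P - A. of_int (if q \<in> C then 1 else 0) * x q) = sum x C"
proof -
  have "(\<Sum>q\<in>P - A. of_int (if q \<in> C then 1 else 0) * x q) = (\<Sum>q\<in>P - A. if q \<in> C then x q else 0)"
    by (intro sum.cong) auto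
  also have "\<dots> = sum x ((P - A) \<inter> C)" using finite_PA by (simp add: sum.inter_restrict)
  finally show ?thesis using assms by (simp add: Int_absorb1)
qed

text \<open>For unmarked \<open>q\<close> the tightest upper bound is the coordinate
  \<open>x q\<close>, by the order conditions in \<open>W\<close>. For marked \<open>q\<close> it is
  a constant, because every element of \<open>W\<close> above \<open>p\<close> also lies above
  \<open>q\<close>.\<close>

lemma equiv_if_least_above:
  assumes q: "lt p q" and least: "\<And>a. lt p a \<Longrightarrow> a = q \<or> lt q a"
  shows "unimodular_equiv (P - A) (chain_order_polytope P lt A lam (insert p W) X)
                                  (chain_order_polytope P lt A lam W (insert p X))"
proof (cases "q \<in> A")
  case True
  define m where "m = Min (lam ` {a\<in>A. lt p a})"
  have fin: "finite (lam ` {a\<in>A. lt p a})" using A_subset finite_P by (simp add: finite_subset)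
  have m_le: "m \<le> lam a" if "a \<in> A" "lt p a" for a unfolding m_def using that fin by (intro Min_le) auto
  have "m \<in> lam ` {a\<in>A. lt p a}" unfolding m_def using True q fin by (intro Min_in) auto
  then obtain a0 where a0: "a0 \<in> A" "lt p a0" "m = lam a0" by auto
  show ?thesis
  proof (rule equiv_if_greatest_upper_bound[where w = "\<lambda>_. 0" and d = "int m"])
    fix x t assume fc: "free_conditions W X x"
    \<comment> \<open>The marking need not be monotone, so the bound is the least mark above \<open>p\<close>, not the mark of \<open>q\<close>.\<close>
    have "real m \<le> lamx A lam x a" if a: "a \<in> A \<union> W" "lt p a" for a
    proof (cases "a \<in> A")
      case True
      then show ?thesis using m_le a by (simp add: lamx_def)
    next
      case False
      then have "a \<in> W" "lt q a" using a least[of a] \<open>q \<in> A\<close> by auto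
      \<comment> \<open>The empty chain between \<open>q\<close> and \<open>a\<close> yields
        \<lambda>_q \<le> x_a.\<close>
      then have "chain_between X a q {}" using \<open>q \<in> A\<close> by (simp add: chain_between_def chain_set_def)
      then have "real (lam q) + sum x {} \<le> lamx A lam x a"
        using fc \<open>a \<in> W\<close> unfolding free_conditions_def by blast
      then show ?thesis using m_le[OF \<open>q \<in> A\<close> q] by simp
    qed
    moreover have "lamx A lam x a0 = real m" using a0 by (simp add: lamx_def)
    ultimately have "upper_bound W p x t \<longleftrightarrow> t \<le> real m"
      unfolding upper_bound_def using a0 by (metis UnCI order_trans)
    then show "upper_bound W p x t \<longleftrightarrow> t \<le> (\<Sum>q\<in>P - A. of_int 0 * x q) + of_int (int m)" by simp
  qed simp
next
  case False
  then have "q \<in> insert p (W \<union> X)" unfolding cover_P using lt_P[OF q] by simp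
  \<comment> \<open>An element above \<open>p\<close> cannot lie in \<open>X\<close>, so the
    unmarked \<open>q\<close> is in the order part.\<close>
  then have "q \<in> W" using q lt_irrefl[of p] no_lt(1)[of p q] by blast
  show ?thesis
  proof (rule equiv_if_greatest_upper_bound[where w = "\<lambda>r. if r \<in> {q} then 1 else 0" and d = 0])
    fix x t assume fc: "free_conditions W X x"
    have lq: "lamx A lam x q = x q" using False by (simp add: lamx_def)
    have "x q \<le> lamx A lam x a" if a: "a \<in> A \<union> W" "lt p a" for a
      using fc a least[of a] \<open>q \<in> W\<close> lq unfolding free_conditions_def by auto
    then have "upper_bound W p x t \<longleftrightarrow> t \<le> x q"
      unfolding upper_bound_def using q lq \<open>q \<in> W\<close> by (metis UnCI order_trans)
    then show "upper_bound W p x t \<longleftrightarrow> t \<le> (\<Sum>r\<in>P - A. of_int (if r \<in> {q} then 1 else 0) * x r) + of_int 0"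
      using sum_indicator_weight[of "{q}" x] W_subset \<open>q \<in> W\<close> by auto
  qed (use q lt_irrefl in auto)
qed

text \<open>The largest lower expression is \<open>c\<close> plus the sum over \<open>T\<close>.
  Since the elements below \<open>p\<close> form a chain, it is attained by \<open>T\<close> started
  at a mark of value \<open>c\<close>; any other chain is cut into its part in \<open>T\<close>,
  bounded by nonnegativity, and the rest, bounded by \<open>c\<close>.\<close>

lemma equiv_if_total_below:
  assumes total: "\<And>r s. lt r p \<Longrightarrow> lt s p \<Longrightarrow> r = s \<or> lt r s \<or> lt s r"
  shows "unimodular_equiv (P - A) (chain_order_polytope P lt A lam (insert p W) X)
                                  (chain_order_polytope P lt A lam W (insert p X))"
proof -
  define B where "B = {b\<in>A. lt b p}"
  have finB: "finite B" using A_subset finite_P by (simp add: B_def finite_subset)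
  have "B \<noteq> {}" using ex_marked_below[OF p_PA] by (auto simp: B_def)
  define c where "c = Max (lam ` B)"
  \<comment> \<open>Lying above every element of \<open>B\<close> lets \<open>T\<close> start from
    any of them, in particular from one carrying the largest mark, which may differ from the topmost
    element.\<close>
  define T where "T = {u\<in>X. lt u p \<and> (\<forall>b\<in>B. lt b u)}"
  have le_c: "lam b \<le> c" if "b \<in> B" for b unfolding c_def using that finB by simp
  have "c \<in> lam ` B" unfolding c_def using finB \<open>B \<noteq> {}\<close> by (intro Max_in) auto
  then obtain b0 where b0: "b0 \<in> B" "c = lam b0" by auto
  obtain m where m: "m \<in> B" "\<And>b. b \<in> B \<Longrightarrow> \<not> lt m b"
    using wfE_min[OF wf_gt, of _ B] \<open>B \<noteq> {}\<close> by (metis all_not_in_conv case_prodI mem_Collect_eq)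
  have m_top: "b = m \<or> lt b m" if "b \<in> B" for b using total[of b m] m that by (auto simp: B_def)
  have finX: "finite X" using X_subset finite_P by (simp add: finite_subset)
  show ?thesis
  proof (rule equiv_if_least_lower_bound[where w = "\<lambda>r. if r \<in> T then 1 else 0" and d = "int c"])
    fix x t assume fc: "free_conditions W X x"
    have nonneg: "0 \<le> x u" if "u \<in> X" for u using fc that unfolding free_conditions_def by blast
    have T_chain: "chain_between X p b0 T"
      using b0 total unfolding chain_between_def chain_set_def T_def B_def by auto
    have "real (lam b) + sum x C \<le> sum x T + real c" if C: "chain_between X p b C" for b C
    proof -
      have CX: "C \<subseteq> X" using C by (simp add: chain_between_def)
      then have finC: "finite C" using finX finite_subset by blast
      have b: "b \<in> B" using C by (simp add: chain_between_def B_def)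
      \<comment> \<open>The part of the chain below the topmost marked element \<open>m\<close> is controlled by the chain condition ending in \<open>m\<close>.\<close>
      have "real (lam b) + sum x (C - T) \<le> real c"
      proof (cases "C - T = {}")
        case True
        show ?thesis unfolding True using le_c[OF b] by simp
      next
        case False
        have below: "lt u m" if u: "u \<in> C - T" for u
        proof -
          have up: "u \<in> X" "lt u p" using u C by (auto simp: chain_between_def)
          then obtain b' where b': "b' \<in> B" "\<not> lt b' u" using u by (auto simp: T_def)
          \<comment> \<open>\<open>u\<close> and \<open>b'\<close> are comparable and distinct, one
            being unmarked and the other marked, and \<open>b'\<close> is not below
            \<open>u\<close>.\<close>
          then have "lt u b'" using total[of u b'] up X_subset by (auto simp: B_def)
          then show ?thesis using m_top[OF b'(1)] lt_trans by blast
        qed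
        have "lt b u" if "u \<in> C" for u using C that by (simp add: chain_between_def)
        moreover from this have "lt b m" using below False lt_trans by blast
        ultimately have "chain_between X m b (C - T)"
          using C below by (auto simp: chain_between_def chain_set_def)
        then have "real (lam b) + sum x (C - T) \<le> lamx A lam x m"
          using fc m False unfolding free_conditions_def B_def by blast
        also have "\<dots> \<le> real c" using m le_c by (simp add: lamx_def B_def)
        finally show ?thesis .
      qed
      moreover have "sum x (C \<inter> T) \<le> sum x T"
        using finX nonneg by (intro sum_mono2) (auto simp: T_def)
      moreover have "sum x C = sum x (C - T) + sum x (C \<inter> T)"
        using sum.Int_Diff[OF finC, of x T] by simp
      ultimately show ?thesis by simp
    qed
    then have "lower_bound X p x t \<longleftrightarrow> sum x T + real c \<le> t"
      unfolding lower_bound_def using T_chain b0(2) by (metis add.commute order_trans)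
    moreover have "T \<subseteq> P - A" using X_subset by (auto simp: T_def)
    ultimately show "lower_bound X p x t \<longleftrightarrow>
        (\<Sum>r\<in>P - A. of_int (if r \<in> T then 1 else 0) * x r) + of_int (int c) \<le> t"
      using sum_indicator_weight by simp
  qed (simp add: T_def p_mem)
qed

text \<open>A non-star element has fewer than two covers or fewer than two maximal chains ending in
  it. The first gives a least element above \<open>p\<close>, the second totality below
  \<open>p\<close>.\<close>

lemma equiv_if_not_star:
  assumes "p \<notin> star_elements P lt"
  shows "unimodular_equiv (P - A) (chain_order_polytope P lt A lam (insert p W) X)
                                  (chain_order_polytope P lt A lam W (insert p X))"
proof (cases "card (covering_set P lt p) < 2")
  case True
  then show ?thesis using unique_cover_least_above[OF p_PA] equiv_if_least_above by metis
next
  case False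
  then have "card (max_chains_to P lt p) < 2" using assms p_mem by (simp add: star_elements_def)
  then show ?thesis
    using unique_max_chain_total_below[OF p_mem(1)] by (intro equiv_if_total_below) blast
qed

end

section \<open>Induction on the difference of two nested order parts\<close>

context marked
begin

text \<open>The elements of \<open>U - W\<close> leave the order part one by one, a minimal one
  first, so that every intermediate decomposition is admissible. None of them is a star element, as
  \<open>U\<close> and \<open>W\<close> have the same star elements.\<close>

lemma equiv_subset:
  assumes "admissible_decomp P lt A U (P - A - U)" "admissible_decomp P lt A W (P - A - W)"
    and "W \<subseteq> U" "U \<inter> star_elements P lt = W \<inter> star_elements P lt"
  shows "unimodular_equiv (P - A) (chain_order_polytope P lt A lam U (P - A - U))
                                  (chain_order_polytope P lt A lam W (P - A - W))"
  using assms
proof (induction "card (U - W)" arbitrary: U rule: less_induct)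
  case less
  have UP: "U \<subseteq> P - A" using less.prems(1) by (auto simp: admissible_decomp_def)
  then have fin: "finite (U - W)" using finite_P by (meson Diff_subset finite_subset)
  show ?case
  proof (cases "U = W")
    case True
    then show ?thesis
      using finite_P by (auto intro!: unimodular_equiv_refl simp: chain_order_polytope_def)
  next
    case False
    then have "U - W \<noteq> {}" using less.prems by blast
    then obtain p where p: "p \<in> U - W" "\<And>q. lt q p \<Longrightarrow> q \<notin> U - W"
      using wfE_min[OF wf_lt, of _ "U - W"] by (metis (no_types, lifting) all_not_in_conv case_prodI mem_Collect_eq)
    define U' where "U' = U - {p}"
    have UU': "U = insert p U'" using p by (auto simp: U'_def)
    have pP: "p \<in> P - A" using p UP by blast
    have compl: "P - A - U' = insert p (P - A - U)" using pP by (auto simp: U'_def)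
    \<comment> \<open>An element of \<open>U'\<close> below \<open>p\<close> is not in
      \<open>U - W\<close> by minimality of \<open>p\<close>, and not in \<open>W\<close> because
      \<open>p\<close> lies in the chain part belonging to \<open>W\<close>.\<close>
    have not_below: "\<not> lt u p" if "u \<in> U'" for u
    proof
      assume u: "lt u p"
      then have "u \<in> W" using p that by (auto simp: U'_def)
      then show False using u less.prems(2) pP p by (auto simp: admissible_decomp_def)
    qed
    have adm': "admissible_decomp P lt A U' (P - A - U')"
      unfolding admissible_decomp_def
    proof (intro conjI notI)
      show "U' \<union> (P - A - U') = P - A" using UP by (auto simp: U'_def)
      assume "\<exists>u1\<in>U'. \<exists>u2\<in>P - A - U'. lt u1 u2"
      then obtain u1 u2 where u: "u1 \<in> U'" "u2 \<in> insert p (P - A - U)" "lt u1 u2"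
        unfolding compl by blast
      then have "u2 \<in> P - A - U" "u1 \<in> U" using not_below by (auto simp: UU')
      then show False using less.prems(1) u(3) unfolding admissible_decomp_def by blast
    qed blast
    interpret move_element P A lt lam p U' "P - A - U"
      using less.prems(1) adm' by unfold_locales (simp_all add: compl UU'[symmetric])
    have "p \<notin> star_elements P lt" using p less.prems(4) by blast
    then have "unimodular_equiv (P - A) (chain_order_polytope P lt A lam U (P - A - U))
                                  (chain_order_polytope P lt A lam U' (P - A - U'))"
      using equiv_if_not_star by (simp add: compl UU'[symmetric])
    moreover have "unimodular_equiv (P - A) (chain_order_polytope P lt A lam U' (P - A - U'))
                                  (chain_order_polytope P lt A lam W (P - A - W))"
    proof (rule less.hyps[OF _ adm' less.prems(2)])
      show "card (U' - W) < card (U - W)"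
        using fin p by (intro psubset_card_mono) (auto simp: U'_def)
    qed (use p less.prems \<open>p \<notin> star_elements P lt\<close> in \<open>auto simp: U'_def\<close>)
    ultimately show ?thesis by (rule unimodular_equiv_trans[OF finite_PA])
  qed
qed

end

section \<open>Comparison through the intersection of the order parts\<close>

theorem theorem4p7:
  fixes P A U1 U2 V1 V2 :: "'a set" and lt :: "'a \<Rightarrow> 'a \<Rightarrow> bool" and lam :: "'a \<Rightarrow> nat"
  assumes "marked_poset P lt A lam"
    and "admissible_decomp P lt A U1 U2"
    and "admissible_decomp P lt A V1 V2"
    and "(U1, U2) \<noteq> (V1, V2)"
    and "U1 \<inter> star_elements P lt = V1 \<inter> star_elements P lt"
  shows "unimodular_equiv (P - A) (chain_order_polytope P lt A lam U1 U2)
                                  (chain_order_polytope P lt A lam V1 V2)"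
proof -
  interpret marked P A lt lam by unfold_locales (rule assms(1))
  have U2: "U2 = P - A - U1" and V2: "V2 = P - A - V1"
    using assms(2,3) unfolding admissible_decomp_def by blast+
  define W where "W = U1 \<inter> V1"
  \<comment> \<open>An element outside \<open>W\<close> is missing from \<open>U1\<close> or from
    \<open>V1\<close>, and admissibility of that decomposition forbids an element of
    \<open>W\<close> below it.\<close>
  have adm: "admissible_decomp P lt A W (P - A - W)"
    using assms(2,3) unfolding W_def admissible_decomp_def by blast
  have UW: "unimodular_equiv (P - A) (chain_order_polytope P lt A lam U1 U2)
                                  (chain_order_polytope P lt A lam W (P - A - W))"
    unfolding U2 using assms adm by (intro equiv_subset) (auto simp: W_def U2)
  have VW: "unimodular_equiv (P - A) (chain_order_polytope P lt A lam V1 V2)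
                                  (chain_order_polytope P lt A lam W (P - A - W))"
    unfolding V2 using assms adm by (intro equiv_subset) (auto simp: W_def V2)
  have fin: "finite (P - A)" using finite_P by simp
  have WV: "unimodular_equiv (P - A) (chain_order_polytope P lt A lam W (P - A - W))
                                  (chain_order_polytope P lt A lam V1 V2)"
    by (rule unimodular_equiv_sym[OF fin _ VW]) (simp add: chain_order_polytope_def)
  show ?thesis by (rule unimodular_equiv_trans[OF fin UW WV])
qed

end
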